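(* Let $0<\delta<1/\sqrt5$. Then $$\dim_H\left(\mathbf{Bad}(\delta)\right)\le \frac{\log 2+\log\left(\left\lceil\frac{648}{\delta^2}\right\rceil-\left\lfloor\frac{36}{\delta}\right\rfloor+2\right)}{2\log\left(\frac{36}{\delta}\right)}<1.$$ If, furthermore, $18/\delta\in\mathbb{N}$, then $$\dim_H\left(\mathbf{Bad}(\delta)\right)\le 1+\frac{\log\left(1-\frac{\delta}{18}+\frac{\delta^2}{648}\right)}{2\log\left(\frac{36}{\delta}\right)}<1.$$
   Context: $\dim_H$ denotes Hausdorff dimension; $\lfloor\cdot\rfloor$ and $\lceil\cdot\rceil$ are floor and ceiling. For $\delta>0$, $\mathbf{Bad}(\delta)$ denotes the set of irrational real numbers $x$ for which there exists an integer $Q>0$ (depending on $x$) such that $|x-p/q|\ge \delta/q^2$ for all integers $q\ge Q$ and all integers $p$ coprime to $q$. *)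

theory Defs
  imports "HOL-Analysis.Analysis"
begin

(* |U|^s with the conventions of Hausdorff measure: |{}|^s = 0 for every s, and |U|^0 = 1 for
   nonempty U.  The case s = 0 is separate because 0 powr 0 = 0 for the library's powr, whereas
   singletons must have weight 1 in the counting measure H^0. *)
definition diam_pow :: "real \<Rightarrow> 'a::metric_space set \<Rightarrow> ennreal" where
  "diam_pow s U =
     (if U = {} then 0 else if s = 0 then 1 else ennreal (diameter U powr s))"

(* Boundedness is explicit because the library's diameter is a real-valued supremum and so carries
   no information on unbounded sets.  Finite covers are included, by padding with the empty set. *)
definition eps_covers :: "real \<Rightarrow> 'a::metric_space set \<Rightarrow> (nat \<Rightarrow> 'a set) set" where
  "eps_covers \<epsilon> A =
     {U. A \<subseteq> (\<Union>i. U i) \<and> (\<forall>i. bounded (U i) \<and> diameter (U i) \<le> \<epsilon>)}"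

definition hausdorff_content :: "real \<Rightarrow> real \<Rightarrow> 'a::metric_space set \<Rightarrow> ennreal" where
  "hausdorff_content s \<epsilon> A = (INF U \<in> eps_covers \<epsilon> A. \<Sum>i. diam_pow s (U i))"

(* The content increases as \<epsilon> decreases, so the limit as \<epsilon> tends to 0 is a supremum. *)
definition hausdorff_measure :: "real \<Rightarrow> 'a::metric_space set \<Rightarrow> ennreal" where
  "hausdorff_measure s A = (SUP \<epsilon> \<in> {0<..}. hausdorff_content s \<epsilon> A)"

(* Extended-real valued, so that the infimum over an empty set of exponents is \<infinity>. *)
definition hausdorff_dim :: "'a::metric_space set \<Rightarrow> ereal" where
  "hausdorff_dim A = (INF s \<in> {s. 0 \<le> s \<and> hausdorff_measure s A = 0}. ereal s)"

definition Bad :: "real \<Rightarrow> real set" where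
  "Bad \<delta> =
     {x. x \<notin> \<rat> \<and>
         (\<exists>Q::int. Q > 0 \<and>
            (\<forall>q::int. q \<ge> Q \<longrightarrow>
               (\<forall>p::int. coprime p q \<longrightarrow>
                  \<bar>x - real_of_int p / real_of_int q\<bar> \<ge> \<delta> / (real_of_int q)\<^sup>2)))}"

end

theory Submission
  imports Defs
begin

text \<open>
  Let $M = \lfloor 1/\delta\rfloor$. The complete quotients of a point of $\mathbf{Bad}(\delta)$
  are eventually confined to $(1, M+1)$. Points with a given initial segment of convergents and
  complete quotient $t \in (1, M+1)$ lie in an interval $J$. The cells $t \in [a, a+1]$,
  $1 \le a \le M$, partition $J$, and confining the next complete quotient to $(1, M+1)$ shrinks each
  cell to at most $M/(M+1)$ of its length. By concavity of $y \mapsto y^s$ the $M$ subintervals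
  $J_a$ satisfy $\sum_a |J_a|^s \le M (M+1)^{-s} |J|^s$, whence
  $\dim_H \mathbf{Bad}(\delta) \le \log M / \log (M+1)$. This is smaller than both bounds of the
  theorem, each of which is at least $1 - 2/(R \log R)$ with $R = 36/\delta \ge 2(M+1)$.
\<close>

section \<open>Hausdorff contents\<close>

lemma hausdorff_content_le_cover:
  assumes "U \<in> eps_covers \<epsilon> A"
  shows "hausdorff_content s \<epsilon> A \<le> (\<Sum>i. diam_pow s (U i))"
  unfolding hausdorff_content_def using assms by (rule INF_lower)

lemma hausdorff_content_mono:
  assumes "A \<subseteq> B" "\<epsilon> \<le> \<epsilon>'"
  shows "hausdorff_content s \<epsilon>' A \<le> hausdorff_content s \<epsilon> B"
  unfolding hausdorff_content_def
proof (rule INF_superset_mono)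
  show "eps_covers \<epsilon> B \<subseteq> eps_covers \<epsilon>' A"
    unfolding eps_covers_def using assms by (auto intro: order_trans)
qed simp

text \<open>The cover is \<open>A\<close> itself padded with empty sets. Bounding pairwise distances
  also supplies the boundedness that \<open>eps_covers\<close> demands.\<close>

lemma hausdorff_content_le_diameter:
  assumes "0 < s" "0 \<le> d" "d \<le> \<epsilon>" and dist: "\<And>x y. x \<in> A \<Longrightarrow> y \<in> A \<Longrightarrow> dist x y \<le> d"
  shows "hausdorff_content s \<epsilon> A \<le> ennreal (d powr s)"
proof -
  define U where "U = (\<lambda>i::nat. if i = 0 then A else {})"
  have bdd: "bounded A"
    unfolding bounded_two_points using dist by blast
  have diam: "diameter A \<le> d"
  proof (cases "A = {}")
    case False
    then show ?thesis
      unfolding diameter_def using dist by (auto intro!: cSUP_least)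
  qed (use assms in auto)
  have "U \<in> eps_covers \<epsilon> A"
    using bdd diam assms by (auto simp: eps_covers_def U_def)
  then have "hausdorff_content s \<epsilon> A \<le> (\<Sum>i. diam_pow s (U i))"
    by (rule hausdorff_content_le_cover)
  also have "\<dots> = (\<Sum>i\<in>{0}. diam_pow s (U i))"
    by (rule suminf_finite) (auto simp: U_def diam_pow_def)
  also have "\<dots> \<le> ennreal (d powr s)"
    using diam assms diameter_ge_0[OF bdd]
    by (auto simp: U_def diam_pow_def intro!: ennreal_leI powr_mono2)
  finally show ?thesis .
qed

text \<open>The sign condition is essential: for negative \<open>\<epsilon>\<close> there are no
  covers, and the infimum is infinite.\<close>

lemma hausdorff_content_empty:
  assumes "0 \<le> \<epsilon>" shows "hausdorff_content s \<epsilon> {} = 0"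
proof -
  have "(\<lambda>_. {}) \<in> eps_covers \<epsilon> {}"
    using assms by (auto simp: eps_covers_def)
  from hausdorff_content_le_cover[OF this, of s] show ?thesis
    by (simp add: diam_pow_def)
qed

text \<open>Covers of the pieces that are optimal up to \<open>e * (1/2)^Suc n\<close> merge into
  one cover of the union, and the errors add up to \<open>e\<close>.\<close>

lemma hausdorff_content_UN_le:
  "hausdorff_content s \<epsilon> (\<Union>i::nat. A i) \<le> (\<Sum>i. hausdorff_content s \<epsilon> (A i))"
proof (rule ennreal_le_epsilon)
  fix e :: real assume e: "0 < e" "(\<Sum>i. hausdorff_content s \<epsilon> (A i)) < top"
  have "\<exists>U. U \<in> eps_covers \<epsilon> (A n) \<and>
      (\<Sum>i. diam_pow s (U i)) \<le> hausdorff_content s \<epsilon> (A n) + ennreal (e * (1/2)^Suc n)" for n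
  proof -
    have "hausdorff_content s \<epsilon> (A n) < top"
      using e(2) by (auto simp add: less_top dest!: ennreal_suminf_lessD)
    then have "\<exists>U\<in>eps_covers \<epsilon> (A n).
        (\<Sum>i. diam_pow s (U i)) < hausdorff_content s \<epsilon> (A n) + ennreal (e * (1/2)^Suc n)"
      using e(1) by (intro INF_approx_ennreal[OF _ hausdorff_content_def]) auto
    then show ?thesis by (auto intro: less_imp_le)
  qed
  then obtain U where U: "\<And>n. U n \<in> eps_covers \<epsilon> (A n)"
    and U_le: "\<And>n. (\<Sum>i. diam_pow s (U n i)) \<le> hausdorff_content s \<epsilon> (A n) + ennreal (e * (1/2)^Suc n)"
    by metis
  \<comment> \<open>The pairing bijection turns the double family into a single sequence, as a cover
    has to be.\<close>
  define V where "V = (\<lambda>i. case prod_decode i of (m, n) \<Rightarrow> U m n)"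
  have "V \<in> eps_covers \<epsilon> (\<Union>i. A i)"
  proof -
    have "x \<in> (\<Union>i. V i)" if x: "x \<in> A m" for x m
    proof -
      obtain n where "x \<in> U m n"
        using U[of m] x by (auto simp: eps_covers_def)
      then have "x \<in> V (prod_encode (m, n))"
        by (simp add: V_def)
      then show ?thesis by blast
    qed
    then show ?thesis
      using U by (auto simp: eps_covers_def V_def split: prod.splits)
  qed
  then have "hausdorff_content s \<epsilon> (\<Union>i. A i) \<le> (\<Sum>i. diam_pow s (V i))"
    by (rule hausdorff_content_le_cover)
  also have "\<dots> = (\<Sum>i. (\<lambda>(m, n). diam_pow s (U m n)) (prod_decode i))"
    by (simp add: V_def split_def)
  also have "\<dots> = (\<Sum>m. \<Sum>n. diam_pow s (U m n))"
    by (rule suminf_ennreal_2dimen) simp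
  also have "\<dots> \<le> (\<Sum>n. hausdorff_content s \<epsilon> (A n) + ennreal (e * (1/2)^Suc n))"
    by (intro suminf_le U_le) auto
  also have "\<dots> = (\<Sum>n. hausdorff_content s \<epsilon> (A n)) + (\<Sum>n. ennreal e * ennreal ((1/2)^Suc n))"
    using e(1) by (subst suminf_add[symmetric])
       (auto simp del: ennreal_suminf_cmult simp add: ennreal_mult[symmetric])
  also have "\<dots> = (\<Sum>n. hausdorff_content s \<epsilon> (A n)) + ennreal e"
    unfolding ennreal_suminf_cmult
    by (subst suminf_ennreal_eq[OF zero_le_power power_half_series]) auto
  finally show "hausdorff_content s \<epsilon> (\<Union>i. A i) \<le> (\<Sum>i. hausdorff_content s \<epsilon> (A i)) + ennreal e" .
qed

lemma hausdorff_content_finite_UN_le: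
  assumes "finite I" "0 \<le> \<epsilon>"
  shows "hausdorff_content s \<epsilon> (\<Union>i\<in>I. A i) \<le> (\<Sum>i\<in>I. hausdorff_content s \<epsilon> (A (i::nat)))"
proof -
  have "hausdorff_content s \<epsilon> (\<Union>i\<in>I. A i)
      = hausdorff_content s \<epsilon> (\<Union>i. if i \<in> I then A i else {})"
    by (rule arg_cong[where f="hausdorff_content s \<epsilon>"]) (auto split: if_splits)
  also have "\<dots> \<le> (\<Sum>i. hausdorff_content s \<epsilon> (if i \<in> I then A i else {}))"
    by (rule hausdorff_content_UN_le)
  also have "\<dots> = (\<Sum>i\<in>I. hausdorff_content s \<epsilon> (if i \<in> I then A i else {}))"
    using assms by (intro suminf_finite) (auto simp: hausdorff_content_empty)
  also have "\<dots> = (\<Sum>i\<in>I. hausdorff_content s \<epsilon> (A i))"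
    by (rule sum.cong) auto
  finally show ?thesis .
qed

section \<open>Null sets of Hausdorff measure\<close>

lemma hausdorff_measure_eq_0_iff:
  "hausdorff_measure s A = 0 \<longleftrightarrow> (\<forall>\<epsilon>>0. hausdorff_content s \<epsilon> A = 0)"
  unfolding hausdorff_measure_def bot_ennreal[symmetric] SUP_bot_conv by auto

lemma hausdorff_measure_mono:
  "A \<subseteq> B \<Longrightarrow> hausdorff_measure s A \<le> hausdorff_measure s B"
  unfolding hausdorff_measure_def by (intro SUP_mono) (auto intro: hausdorff_content_mono)

text \<open>Indexing by an arbitrary countable type lets the lemma apply directly to families
  indexed by tuples of integers.\<close>

lemma hausdorff_measure_UN_eq_0:
  fixes A :: "'i::countable \<Rightarrow> 'a::metric_space set"
  assumes "\<And>i. i \<in> I \<Longrightarrow> hausdorff_measure s (A i) = 0"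
  shows "hausdorff_measure s (\<Union>i\<in>I. A i) = 0"
proof -
  have "hausdorff_content s \<epsilon> (\<Union>i\<in>I. A i) = 0" if "\<epsilon> > 0" for \<epsilon>
  proof -
    define B where "B = (\<lambda>n. if n \<in> to_nat ` I then A (from_nat n) else {})"
    have "hausdorff_content s \<epsilon> (B n) = 0" for n
      using assms that by (auto simp: B_def hausdorff_measure_eq_0_iff hausdorff_content_empty)
    moreover have "(\<Union>i\<in>I. A i) \<subseteq> (\<Union>n. B n)"
    proof
      fix x assume "x \<in> (\<Union>i\<in>I. A i)"
      then obtain i where "i \<in> I" "x \<in> A i" by blast
      then have "x \<in> B (to_nat i)" by (simp add: B_def)
      then show "x \<in> (\<Union>n. B n)" by blast
    qed
    ultimately have "hausdorff_content s \<epsilon> (\<Union>i\<in>I. A i) \<le> 0"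
      using hausdorff_content_mono[of "\<Union>i\<in>I. A i" "\<Union>n. B n" \<epsilon> \<epsilon> s]
        hausdorff_content_UN_le[of s \<epsilon> B] by simp
    then show ?thesis by simp
  qed
  then show ?thesis by (simp add: hausdorff_measure_eq_0_iff)
qed

section \<open>Cylinders of bounded continued fractions\<close>

text \<open>Concavity of the \<open>s\<close>-th power, applied through its tangent at the mean
  \<open>l\<close>: Young's inequality bounds each \<open>c i powr s * l powr (1 - s)\<close> by a
  linear expression, and these sum to \<open>S\<close>.\<close>

lemma sum_powr_le:
  fixes c :: "'i \<Rightarrow> real"
  assumes s: "0 < s" "s \<le> 1" and c: "\<And>i. i \<in> I \<Longrightarrow> 0 < c i" and I: "finite I" "I \<noteq> {}"
  shows "(\<Sum>i\<in>I. c i powr s) \<le> real (card I) powr (1 - s) * (\<Sum>i\<in>I. c i) powr s"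
proof -
  define S where "S = (\<Sum>i\<in>I. c i)"
  define l where "l = S / card I"
  have n: "real (card I) > 0" using I by (simp add: card_gt_0_iff)
  have S: "S > 0" unfolding S_def using I c by (intro sum_pos) auto
  then have l: "l > 0" using n by (simp add: l_def)
  have "(\<Sum>i\<in>I. c i powr s) * l powr (1 - s) = (\<Sum>i\<in>I. c i powr s * l powr (1 - s))"
    by (simp add: sum_distrib_right)
  also have "\<dots> \<le> (\<Sum>i\<in>I. s * c i + (1 - s) * l)"
    using s l c by (intro sum_mono Youngs_inequality_0) auto
  also have "\<dots> = s * S + (1 - s) * (card I * l)"
    by (simp add: sum.distrib S_def sum_distrib_left)
  also have "\<dots> = S" using n by (simp add: l_def algebra_simps)
  finally have "(\<Sum>i\<in>I. c i powr s) \<le> S / l powr (1 - s)"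
    using l by (simp add: field_simps)
  also have "S / l powr (1 - s) = card I powr (1 - s) * (S powr 1 / S powr (1 - s))"
    using n S by (simp add: l_def powr_divide)
  also have "S powr 1 / S powr (1 - s) = S powr s"
    by (subst powr_diff[symmetric]) simp
  finally show ?thesis by (simp add: S_def)
qed

text \<open>Distance between the values at \<open>t = 1\<close> and \<open>t = M + 1\<close> of the
  map \<open>(p * t + p') / (q * t + q')\<close> when its determinant is 1 or -1. The numerators
  cancel, so only denominators appear.\<close>

definition cyl_len :: "nat \<Rightarrow> int \<Rightarrow> int \<Rightarrow> real" where
  "cyl_len M q q' = real M / ((q + q') * (q * (real M + 1) + q'))"

text \<open>If $p'/q'$ and $p/q$ are consecutive convergents of $x$, then $t$ is the next complete
  quotient of $x$.\<close>

definition bad_cyl :: "real \<Rightarrow> nat \<Rightarrow> int \<Rightarrow> int \<Rightarrow> int \<Rightarrow> int \<Rightarrow> int \<Rightarrow> real set" where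
  "bad_cyl \<delta> M Q p q p' q' =
     {x. (\<exists>t. 1 < t \<and> t < real M + 1 \<and> t \<notin> \<rat> \<and> x = (p * t + p') / (q * t + q')) \<and>
         (\<forall>n\<ge>Q. \<forall>m::int. coprime m n \<longrightarrow> \<delta> / (real_of_int n)\<^sup>2 \<le> \<bar>x - m / n\<bar>)}"

lemma cyl_len_pos:
  assumes "0 < M" "0 < q" "0 \<le> q'"
  shows "0 < cyl_len M q q'"
proof -
  have "0 < real_of_int q + q'" "0 < q * (real M + 1) + q'"
    using assms by (auto intro!: add_pos_nonneg)
  then show ?thesis using assms by (simp add: cyl_len_def)
qed

text \<open>The summand is the length of the cell with \<open>t\<close> between \<open>a\<close> and
  \<open>a + 1\<close>, and the cells tile the interval with \<open>t\<close> between 1 and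
  \<open>M + 1\<close>.\<close>

lemma sum_cells:
  fixes q q' :: real
  assumes "0 < q" "0 \<le> q'"
  shows "(\<Sum>a=1..M. 1 / ((q * real a + q') * (q * (real a + 1) + q')))
    = real M / ((q + q') * (q * (real M + 1) + q'))"
proof (induction M)
  case (Suc M)
  have pos: "0 < q + q'" "0 < q * (real M + 1) + q'" "0 < q * (real M + 2) + q'"
    using assms by (auto intro!: add_pos_nonneg)
  \<comment> \<open>\<open>A\<close>, \<open>B\<close>, \<open>C\<close> are the values of
    \<open>q * t + q'\<close> at \<open>t = 1\<close>, \<open>M + 1\<close>, \<open>M + 2\<close>.
    Naming them reduces the induction step to one polynomial identity.\<close>
  have "real M / (A * B) + 1 / (B * C) = (real M + 1) / (A * C)"
    if "A = q + q'" "B = q * (real M + 1) + q'" "C = q * (real M + 2) + q'" for A B C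
  proof -
    have "A > 0" "B > 0" "C > 0" using pos that by auto
    moreover have "real M * C + A = (real M + 1) * B"
      unfolding that by algebra
    ultimately show ?thesis
      by (simp add: divide_simps)
  qed
  with Suc show ?case by (simp add: add_ac)
qed simp

text \<open>A child occupies at most the fraction \<open>r = M / (M + 1)\<close> of its cell.
  Concavity over the \<open>M\<close> cells contributes \<open>M powr (1 - s)\<close>, and together
  with \<open>r powr s\<close> this gives the stated factor.\<close>

lemma sum_cyl_len_powr_le:
  assumes M: "0 < M" and q: "0 < q" "0 \<le> q'" and s: "0 < s" "s \<le> 1"
  shows "(\<Sum>a=1..M. cyl_len M (q * int a + q') q powr s)
    \<le> real M / (real M + 1) powr s * cyl_len M q q' powr s"
proof -
  define c where "c a = 1 / ((q * real a + q') * (q * (real a + 1) + q'))" for a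
  define r where "r = real M / (real M + 1)"
  have r: "r > 0" using M by (simp add: r_def)
  have c: "c a > 0" if "a \<in> {1..M}" for a
    using q that by (auto simp: c_def intro!: mult_pos_pos add_pos_nonneg)
  have sum_c: "sum c {1..M} = cyl_len M q q'"
    unfolding c_def cyl_len_def using q by (subst sum_cells) auto
  have len: "0 \<le> cyl_len M (q * int a + q') q"
    "cyl_len M (q * int a + q') q \<le> r * c a" if "a \<in> {1..M}" for a
  proof -
    define Q where "Q = q * real a + q'"
    have Q: "Q > 0" using q that by (auto simp: Q_def intro!: add_pos_nonneg)
    have "cyl_len M (q * int a + q') q = real M / ((Q + q) * (Q * (real M + 1) + q))"
      by (simp add: cyl_len_def Q_def)
    \<comment> \<open>Dropping the positive \<open>q\<close> from the second factor separates the
      ratio \<open>r\<close> from the cell length \<open>c a\<close>.\<close>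
    also have "\<dots> \<le> real M / ((Q + q) * (Q * (real M + 1)))"
      using Q q M by (intro divide_left_mono mult_left_mono mult_pos_pos) (auto intro!: add_pos_pos)
    also have "\<dots> = r * c a"
      by (simp add: r_def c_def Q_def algebra_simps)
    finally show "cyl_len M (q * int a + q') q \<le> r * c a" .
    show "0 \<le> cyl_len M (q * int a + q') q"
      using Q q by (auto simp: cyl_len_def Q_def)
  qed
  have "(\<Sum>a=1..M. cyl_len M (q * int a + q') q powr s) \<le> (\<Sum>a=1..M. (r * c a) powr s)"
    using len s by (intro sum_mono powr_mono2) auto
  also have "\<dots> = r powr s * (\<Sum>a=1..M. c a powr s)"
    using r c by (simp add: powr_mult sum_distrib_left less_imp_le)
  also have "\<dots> \<le> r powr s * (M powr (1 - s) * cyl_len M q q' powr s)"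
    using sum_powr_le[of s "{1..M}" c] c s M sum_c by (intro mult_left_mono) auto
  also have "r powr s * (M powr (1 - s) * cyl_len M q q' powr s)
    = (real M powr s * real M powr (1 - s)) / (real M + 1) powr s * cyl_len M q q' powr s"
    by (simp add: r_def powr_divide)
  also have "real M powr s * real M powr (1 - s) = M"
    using M by (simp flip: powr_add)
  finally show ?thesis .
qed

text \<open>The case \<open>s = 1\<close> of the sum bound, since one child is at most the sum of
  all. It makes diameters shrink geometrically with depth.\<close>

lemma cyl_len_child_le:
  assumes M: "0 < M" and q: "0 < q" "0 \<le> q'" and a: "a \<in> {1..M}"
  shows "cyl_len M (q * int a + q') q \<le> real M / (real M + 1) * cyl_len M q q'"
proof -
  have "cyl_len M (q * int a + q') q = cyl_len M (q * int a + q') q powr 1"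
    using q a by (subst powr_one) (auto intro!: less_imp_le cyl_len_pos M add_pos_nonneg mult_pos_pos)
  also have "\<dots> \<le> (\<Sum>a=1..M. cyl_len M (q * int a + q') q powr 1)"
    using a by (intro member_le_sum) auto
  also have "\<dots> \<le> real M / (real M + 1) powr 1 * cyl_len M q q' powr 1"
    using assms by (intro sum_cyl_len_powr_le) auto
  finally show ?thesis
    using cyl_len_pos[OF M q] by simp
qed

section \<open>Diameters of cylinders and passage to the next complete quotient\<close>

lemma dist_bad_cyl_le:
  assumes q: "0 < q" "0 \<le> q'" and det: "\<bar>p * q' - p' * q\<bar> = 1"
    and x: "x \<in> bad_cyl \<delta> M Q p q p' q'" and y: "y \<in> bad_cyl \<delta> M Q p q p' q'"
  shows "dist x y \<le> cyl_len M q q'"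
proof -
  define f where "f t = (p * t + p') / (q * t + q')" for t :: real
  have pos: "0 < q * t + q'" if "1 \<le> t" for t :: real
    using q that by (auto intro!: add_pos_nonneg)
  have diff: "\<bar>f t - f u\<bar> = (t - u) / ((q * t + q') * (q * u + q'))" if "1 \<le> u" "u \<le> t" for t u :: real
  proof -
    have "f t - f u = ((p * t + p') * (q * u + q') - (p * u + p') * (q * t + q'))
        / ((q * t + q') * (q * u + q'))"
      using pos[of t] pos[of u] that by (simp add: f_def diff_frac_eq)
    also have "(p * t + p') * (q * u + q') - (p * u + p') * (q * t + q')
        = of_int (p * q' - p' * q) * (t - u)"
      by (simp add: algebra_simps)
    finally have "\<bar>f t - f u\<bar> = \<bar>of_int (p * q' - p' * q)\<bar> * \<bar>t - u\<bar>
        / (\<bar>q * t + q'\<bar> * \<bar>q * u + q'\<bar>)"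
      by (simp add: abs_mult)
    moreover have "\<bar>real_of_int (p * q' - p' * q)\<bar> = 1"
      using det by linarith
    ultimately show ?thesis
      using pos[of t] pos[of u] that by simp
  qed
  have le: "\<bar>f t - f u\<bar> \<le> cyl_len M q q'" if tu: "1 \<le> u" "u \<le> t" "t \<le> real M + 1" for t u :: real
  proof -
    \<comment> \<open>In partial fractions the distance is visibly monotone in each endpoint, so it
      is largest at \<open>u = 1\<close>, \<open>t = M + 1\<close>.\<close>
    have split: "(t - u) / ((q * t + q') * (q * u + q')) = (1 / (q * u + q') - 1 / (q * t + q')) / q"
      if "1 \<le> u" "u \<le> t" for t u :: real
      using pos[of t] pos[of u] that q by (simp add: divide_simps) (simp add: algebra_simps)
    have "\<bar>f t - f u\<bar> = (1 / (q * u + q') - 1 / (q * t + q')) / q"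
      using trans[OF diff split] tu by blast
    also have "\<dots> \<le> (1 / (q * 1 + q') - 1 / (q * (real M + 1) + q')) / q"
      using tu q pos by (intro divide_right_mono diff_mono divide_left_mono add_mono mult_left_mono mult_pos_pos) auto
    also have "\<dots> = cyl_len M q q'"
      using tu split[of 1 "real M + 1"] by (simp add: cyl_len_def mult.commute)
    finally show ?thesis .
  qed
  obtain t u where "1 < t" "t < real M + 1" "x = f t" "1 < u" "u < real M + 1" "y = f u"
    using x y by (auto simp: bad_cyl_def f_def)
  then show ?thesis
    using le[of t u] le[of u t] by (cases "t \<le> u") (auto simp: dist_real_def abs_minus_commute)
qed

text \<open>One step of the continued fraction algorithm: \<open>a\<close> is the integer part of
  \<open>t\<close> and \<open>u\<close> the reciprocal of its fractional part. Irrationality of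
  \<open>t\<close> keeps that part nonzero and passes on to \<open>u\<close>.\<close>

lemma complete_quotient_step:
  fixes p q p' q' :: int and t :: real
  assumes q: "0 < q" "0 \<le> q'" and t: "1 < t" "t \<notin> \<rat>" and x: "x = (p * t + p') / (q * t + q')"
  obtains a :: nat and u :: real
  where "1 \<le> a" "a < t" "1 < u" "u \<notin> \<rat>"
    "x = ((p * int a + p') * u + p) / ((q * int a + q') * u + q)"
proof -
  define a where "a = nat \<lfloor>t\<rfloor>"
  define u where "u = 1 / (t - a)"
  have a: "real a = \<lfloor>t\<rfloor>" "1 \<le> a" using t by (auto simp: a_def le_nat_iff)
  have "t \<noteq> a" using t by auto
  moreover have "real a \<le> t" "t < a + 1" using a by linarith+
  ultimately have ta: "a < t" "t - a < 1" by auto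
  have u1: "1 < u" using ta by (simp add: u_def)
  have t_eq: "t = a + 1 / u" using ta by (simp add: u_def)
  have "u \<notin> \<rat>"
  proof
    assume "u \<in> \<rat>"
    then have "a + 1 / u \<in> \<rat>" by auto
    with t t_eq show False by simp
  qed
  moreover have "x = ((p * int a + p') * u + p) / ((q * int a + q') * u + q)"
  proof -
    have "x = ((p * t + p') * u) / ((q * t + q') * u)"
      using u1 by (simp add: x)
    also have "(p * t + p') * u = (p * int a + p') * u + p"
      using u1 by (simp add: t_eq field_simps)
    also have "(q * t + q') * u = (q * int a + q') * u + q"
      using u1 by (simp add: t_eq field_simps)
    finally show ?thesis by simp
  qed
  ultimately show thesis using that[of a u] a ta u1 by auto
qed

text \<open>The convergent $p/q$ lies within $1/(q(qt+q'))$ of $x$, so badness forces $t \le 1/\delta$.\<close>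

lemma complete_quotient_bound:
  fixes p q p' q' :: int and t :: real
  assumes \<delta>: "0 < \<delta>" "1 / \<delta> < real M + 1"
    and q: "0 < q" "0 \<le> q'" and det: "\<bar>p * q' - p' * q\<bar> = 1" and t: "1 < t"
    and x: "x = (p * t + p') / (q * t + q')"
    and bad: "\<delta> / (real_of_int q)\<^sup>2 \<le> \<bar>x - p / q\<bar>"
  shows "t < real M + 1"
proof -
  have pos: "0 < q * t + q'" using q t by (auto intro!: add_pos_nonneg)
  have "x - p / q = - of_int (p * q' - p' * q) / (q * (q * t + q'))"
    unfolding x using q pos by (simp add: divide_simps) (simp add: algebra_simps)
  then have "\<bar>x - p / q\<bar> = \<bar>of_int (p * q' - p' * q)\<bar> / (q * (q * t + q'))"
    using q pos by (simp add: abs_mult)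
  also have "\<bar>real_of_int (p * q' - p' * q)\<bar> = 1" using det by linarith
  finally have "\<delta> / (real_of_int q)\<^sup>2 \<le> 1 / (q * (q * t + q'))"
    using bad by simp
  then have "\<delta> * (q * (q * t + q')) \<le> (real_of_int q)\<^sup>2"
    using q pos by (simp add: pos_divide_le_eq pos_le_divide_eq mult_pos_pos del: mult_less_cancel_left)
  then have "\<delta> * (q * t + q') \<le> q"
    using q by (simp add: power2_eq_square mult.left_commute)
  moreover have "\<delta> * (q * t) \<le> \<delta> * (q * t + q')"
    using \<delta> q by simp
  ultimately have "q * (\<delta> * t) \<le> q * (1::real)" by (simp add: mult_ac)
  then have "\<delta> * t \<le> 1" using q by (simp only: mult_le_cancel_left_pos of_int_0_less_iff)
  then have "t \<le> 1 / \<delta>" using \<delta> by (simp add: field_simps)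
  then show ?thesis using \<delta> by simp
qed

text \<open>The determinant changes sign at each step, so its absolute value is the invariant
  carried along.\<close>

lemma det_child:
  fixes p q p' q' a :: int
  assumes "\<bar>p * q' - p' * q\<bar> = 1"
  shows "\<bar>(p * a + p') * q - p * (q * a + q')\<bar> = 1"
proof -
  have "(p * a + p') * q - p * (q * a + q') = - (p * q' - p' * q)" by algebra
  then show ?thesis using assms by simp
qed

text \<open>This makes every convergent an admissible fraction in the condition defining
  \<open>Bad\<close>.\<close>

lemma coprime_of_det:
  fixes p q p' q' :: int
  assumes "\<bar>p * q' - p' * q\<bar> = 1"
  shows "coprime p q"
proof (rule coprimeI)
  fix d assume "d dvd p" "d dvd q"
  then have "d dvd \<bar>p * q' - p' * q\<bar>" by simp
  then show "is_unit d" using assms by simp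
qed

text \<open>Since \<open>a \<ge> 1\<close>, the next denominator is at least
  \<open>q + q' \<ge> Q\<close>. The badness condition thus applies to the next convergent and
  confines the next complete quotient.\<close>

lemma bad_cyl_subset_children:
  assumes \<delta>: "0 < \<delta>" "1 / \<delta> < real M + 1"
    and q: "0 < q" "0 \<le> q'" and det: "\<bar>p * q' - p' * q\<bar> = 1" and Q: "Q \<le> q + q'"
  shows "bad_cyl \<delta> M Q p q p' q'
    \<subseteq> (\<Union>a\<in>{1..M}. bad_cyl \<delta> M Q (p * int a + p') (q * int a + q') p q)"
proof
  fix x assume x: "x \<in> bad_cyl \<delta> M Q p q p' q'"
  then obtain t :: real where t: "1 < t" "t < real M + 1" "t \<notin> \<rat>" "x = (p * t + p') / (q * t + q')"
    unfolding bad_cyl_def by blast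
  obtain a :: nat and u :: real where au: "1 \<le> a" "a < t" "1 < u" "u \<notin> \<rat>"
    "x = ((p * int a + p') * u + p) / ((q * int a + q') * u + q)"
    by (rule complete_quotient_step[OF q t(1,3,4)])
  let ?P = "p * int a + p'" and ?Q = "q * int a + q'"
  have det': "\<bar>?P * q - p * ?Q\<bar> = 1" using det by (rule det_child)
  have "q \<le> q * int a" using au(1) q by simp
  then have Q': "0 < ?Q" "Q \<le> ?Q" using q Q by linarith+
  have bad: "\<forall>n\<ge>Q. \<forall>m::int. coprime m n \<longrightarrow> \<delta> / (real_of_int n)\<^sup>2 \<le> \<bar>x - m / n\<bar>"
    using x unfolding bad_cyl_def by blast
  then have "\<delta> / (real_of_int ?Q)\<^sup>2 \<le> \<bar>x - ?P / ?Q\<bar>"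
    using Q' coprime_of_det[OF det'] by blast
  then have "u < real M + 1"
    using complete_quotient_bound[OF \<delta> Q'(1) _ det' au(3)] au(5) q by auto
  then have "x \<in> bad_cyl \<delta> M Q ?P ?Q p q"
    using au bad by (auto simp: bad_cyl_def)
  moreover have "a \<in> {1..M}" using au t by auto
  ultimately show "x \<in> (\<Union>a\<in>{1..M}. bad_cyl \<delta> M Q (p * int a + p') (q * int a + q') p q)"
    by blast
qed

section \<open>Hausdorff measure of a cylinder\<close>

text \<open>Subdividing \<open>n\<close> times multiplies the sum of \<open>s\<close>-th powers by
  at most \<open>M / (M + 1) powr s\<close> per level. The hypothesis on \<open>\<epsilon>\<close>
  ensures that the cylinders at depth \<open>n\<close> are small enough to be used as covering
  sets.\<close>

lemma hausdorff_content_bad_cyl_le: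
  assumes \<delta>: "0 < \<delta>" "1 / \<delta> < real M + 1" and M: "0 < M" and s: "0 < s" "s \<le> 1"
    and q: "0 < q" "0 \<le> q'" and det: "\<bar>p * q' - p' * q\<bar> = 1" and Q: "Q \<le> q + q'"
    and \<epsilon>: "(real M / (real M + 1)) ^ n * cyl_len M q q' \<le> \<epsilon>"
  shows "hausdorff_content s \<epsilon> (bad_cyl \<delta> M Q p q p' q')
    \<le> ennreal ((real M / (real M + 1) powr s) ^ n * cyl_len M q q' powr s)"
  using q det Q \<epsilon>
proof (induction n arbitrary: p q p' q')
  case 0
  have "hausdorff_content s \<epsilon> (bad_cyl \<delta> M Q p q p' q') \<le> ennreal (cyl_len M q q' powr s)"
    using 0 s cyl_len_pos[OF M, of q q'] dist_bad_cyl_le[of q q' p p']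
    by (intro hausdorff_content_le_diameter) auto
  then show ?case by simp
next
  case (Suc n)
  let ?r = "real M / (real M + 1)" and ?\<rho> = "real M / (real M + 1) powr s"
  let ?J = "\<lambda>a::nat. cyl_len M (q * int a + q') q"
  let ?C = "\<lambda>a::nat. bad_cyl \<delta> M Q (p * int a + p') (q * int a + q') p q"
  have pos: "0 < cyl_len M q q'" using Suc.prems M by (intro cyl_len_pos) auto
  have "0 \<le> ?r ^ Suc n * cyl_len M q q'" using pos by simp
  then have \<epsilon>0: "0 \<le> \<epsilon>" using Suc.prems(5) by linarith
  have child: "hausdorff_content s \<epsilon> (?C a) \<le> ennreal (?\<rho> ^ n * ?J a powr s)"
    if a: "a \<in> {1..M}" for a
  proof (rule Suc.IH)
    have "q \<le> q * int a" using a Suc.prems(1) by simp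
    then show "0 < q * int a + q'" "Q \<le> q * int a + q' + q"
      using Suc.prems(1,2,4) by linarith+
    show "0 \<le> q" using Suc.prems(1) by simp
    show "\<bar>(p * int a + p') * q - p * (q * int a + q')\<bar> = 1"
      using Suc.prems(3) by (rule det_child)
    have "?r ^ n * ?J a \<le> ?r ^ n * (?r * cyl_len M q q')"
      using cyl_len_child_le[OF M Suc.prems(1,2) a] by (intro mult_left_mono) auto
    also have "\<dots> \<le> \<epsilon>" using Suc.prems(5) by (simp add: mult_ac)
    finally show "?r ^ n * ?J a \<le> \<epsilon>" .
  qed
  have "hausdorff_content s \<epsilon> (bad_cyl \<delta> M Q p q p' q') \<le> hausdorff_content s \<epsilon> (\<Union>a\<in>{1..M}. ?C a)"
    using bad_cyl_subset_children[OF \<delta> Suc.prems(1-4)] by (intro hausdorff_content_mono) auto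
  also have "\<dots> \<le> (\<Sum>a=1..M. hausdorff_content s \<epsilon> (?C a))"
    using \<epsilon>0 by (intro hausdorff_content_finite_UN_le) auto
  also have "\<dots> \<le> (\<Sum>a=1..M. ennreal (?\<rho> ^ n * ?J a powr s))"
    by (intro sum_mono child)
  also have "\<dots> = ennreal (?\<rho> ^ n * (\<Sum>a=1..M. ?J a powr s))"
    by (simp add: sum_ennreal sum_distrib_left)
  also have "\<dots> \<le> ennreal (?\<rho> ^ n * (?\<rho> * cyl_len M q q' powr s))"
    using sum_cyl_len_powr_le[OF M Suc.prems(1,2) s] by (intro ennreal_leI mult_left_mono) auto
  finally show ?case by (simp add: mult_ac)
qed

text \<open>The condition on \<open>s\<close> makes the factor per level less than 1, so the content
  bounds tend to 0 with the depth. For fixed \<open>\<epsilon>\<close> they hold at all large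
  depths.\<close>

lemma hausdorff_measure_bad_cyl:
  assumes \<delta>: "0 < \<delta>" "1 / \<delta> < real M + 1" and M: "0 < M" and s: "0 < s" "s \<le> 1"
    and \<rho>: "real M < (real M + 1) powr s"
    and q: "0 < q" "0 \<le> q'" and det: "\<bar>p * q' - p' * q\<bar> = 1" and Q: "Q \<le> q + q'"
  shows "hausdorff_measure s (bad_cyl \<delta> M Q p q p' q') = 0"
  unfolding hausdorff_measure_eq_0_iff
proof (intro allI impI)
  fix \<epsilon> :: real assume \<epsilon>: "0 < \<epsilon>"
  let ?r = "real M / (real M + 1)" and ?\<rho> = "real M / (real M + 1) powr s"
  have "(\<lambda>n. ?r ^ n * cyl_len M q q') \<longlonglongrightarrow> 0 * cyl_len M q q'"
    by (intro tendsto_mult tendsto_const LIMSEQ_power_zero) auto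
  then have "\<forall>\<^sub>F n in sequentially. ?r ^ n * cyl_len M q q' < \<epsilon>"
    using \<epsilon> by (intro order_tendstoD) auto
  then have ev: "\<forall>\<^sub>F n in sequentially. hausdorff_content s \<epsilon> (bad_cyl \<delta> M Q p q p' q')
      \<le> ennreal (?\<rho> ^ n * cyl_len M q q' powr s)"
    by eventually_elim (intro hausdorff_content_bad_cyl_le assms less_imp_le)
  have "(\<lambda>n. ?\<rho> ^ n * cyl_len M q q' powr s) \<longlonglongrightarrow> 0 * cyl_len M q q' powr s"
    using \<rho> M by (intro tendsto_mult tendsto_const LIMSEQ_power_zero) (auto simp: field_simps)
  then have lim: "(\<lambda>n. ennreal (?\<rho> ^ n * cyl_len M q q' powr s)) \<longlonglongrightarrow> ennreal 0"
    by (intro tendsto_ennrealI) simp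
  have "hausdorff_content s \<epsilon> (bad_cyl \<delta> M Q p q p' q') \<le> ennreal 0"
    by (rule tendsto_lowerbound[OF lim ev]) simp
  then show "hausdorff_content s \<epsilon> (bad_cyl \<delta> M Q p q p' q') = 0" by simp
qed

section \<open>Covering \<open>Bad\<close> by countably many cylinders\<close>

text \<open>Running the algorithm for \<open>k\<close> steps makes \<open>q + q'\<close> at least
  \<open>k\<close>, so any threshold on denominators is eventually reached.\<close>

lemma irrational_convergent:
  fixes x :: real
  assumes "x \<notin> \<rat>"
  shows "\<exists>p q p' q' :: int. \<exists>t :: real. 0 < q \<and> 0 \<le> q' \<and> \<bar>p * q' - p' * q\<bar> = 1 \<and> int k \<le> q + q' \<and>
    1 < t \<and> t \<notin> \<rat> \<and> x = (p * t + p') / (q * t + q')"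
proof (induction k)
  case 0
  \<comment> \<open>The start is the convergent \<open>\<lfloor>x\<rfloor> / 1\<close> with formal
    predecessor \<open>1 / 0\<close>, which is why \<open>q' = 0\<close> is allowed.\<close>
  define t where "t = 1 / frac x"
  have "x \<notin> \<int>" using assms Ints_subset_Rats by blast
  then have f: "0 < frac x" "frac x < 1" by (auto simp: frac_lt_1 frac_gt_0_iff)
  then have t1: "1 < t" by (simp add: t_def)
  have x: "x = \<lfloor>x\<rfloor> + 1 / t" by (simp add: t_def frac_def)
  have "t \<notin> \<rat>"
  proof
    assume "t \<in> \<rat>"
    then have "\<lfloor>x\<rfloor> + 1 / t \<in> \<rat>" by auto
    with x have "x \<in> \<rat>" by (rule ssubst)
    with assms show False by simp
  qed
  moreover have "\<lfloor>x\<rfloor> + 1 / t = (of_int \<lfloor>x\<rfloor> * t + of_int 1) / (of_int 1 * t + of_int 0)"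
    using t1 by (simp add: field_simps)
  with x have "x = (of_int \<lfloor>x\<rfloor> * t + of_int 1) / (of_int 1 * t + of_int 0)"
    by (rule trans)
  ultimately show ?case
    using t1 by (intro exI[of _ "\<lfloor>x\<rfloor>"] exI[of _ "1::int"] exI[of _ "0::int"] exI[of _ t]) auto
next
  case (Suc k)
  then obtain p q p' q' :: int and t :: real
    where q: "0 < q" "0 \<le> q'" and det: "\<bar>p * q' - p' * q\<bar> = 1" and k: "int k \<le> q + q'"
      and t: "1 < t" "t \<notin> \<rat>" "x = (p * t + p') / (q * t + q')"
    by (elim exE conjE) (rule that)
  obtain a :: nat and u :: real where au: "1 \<le> a" "a < t" "1 < u" "u \<notin> \<rat>"
    "x = ((p * int a + p') * u + p) / ((q * int a + q') * u + q)"
    by (rule complete_quotient_step[OF q t])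
  have "q \<le> q * int a" using au(1) q by simp
  then have "0 < q * int a + q'" "0 \<le> q" "int (Suc k) \<le> (q * int a + q') + q"
    using q k by linarith+
  then show ?case
    using au(3-) det_child[OF det, of "int a"]
    by (intro exI[of _ "p * int a + p'"] exI[of _ "q * int a + q'"] exI[of _ p] exI[of _ q] exI[of _ u]) auto
qed

lemma hausdorff_measure_Bad:
  assumes \<delta>: "0 < \<delta>" "1 / \<delta> < real M + 1" and M: "0 < M" and s: "0 < s" "s \<le> 1"
    and \<rho>: "real M < (real M + 1) powr s"
  shows "hausdorff_measure s (Bad \<delta>) = 0"
proof -
  \<comment> \<open>The threshold \<open>Q\<close> depends on the point, so it is part of the index.
    Five integers still leave countably many cylinders.\<close>
  define I where "I = {(Q :: int, p :: int, q :: int, p' :: int, q' :: int).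
    0 < q \<and> 0 \<le> q' \<and> \<bar>p * q' - p' * q\<bar> = 1 \<and> Q \<le> q + q'}"
  define C where "C = (\<lambda>(Q, p, q, p', q'). bad_cyl \<delta> M Q p q p' q')"
  have "Bad \<delta> \<subseteq> (\<Union>i\<in>I. C i)"
  proof
    fix x assume "x \<in> Bad \<delta>"
    then obtain Q where x: "x \<notin> \<rat>" and
      bad: "\<forall>n\<ge>Q. \<forall>m::int. coprime m n \<longrightarrow> \<delta> / (real_of_int n)\<^sup>2 \<le> \<bar>x - m / n\<bar>"
      by (auto simp: Bad_def)
    obtain p q p' q' :: int and t :: real
      where q: "0 < q" "0 \<le> q'" and det: "\<bar>p * q' - p' * q\<bar> = 1" and k: "int (nat Q) \<le> q + q'"
        and t: "1 < t" "t \<notin> \<rat>" "x = (p * t + p') / (q * t + q')"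
      using irrational_convergent[OF x, of "nat Q"] by (elim exE conjE) (rule that)
    \<comment> \<open>One further step is taken because \<open>q\<close> itself may lie below
      \<open>Q\<close>, leaving \<open>t\<close> without a bound. The new denominator is at least
      \<open>q + q' \<ge> Q\<close>, so \<open>u\<close> is bounded.\<close>
    obtain a :: nat and u :: real where au: "1 \<le> a" "a < t" "1 < u" "u \<notin> \<rat>"
      "x = ((p * int a + p') * u + p) / ((q * int a + q') * u + q)"
      by (rule complete_quotient_step[OF q t])
    let ?P = "p * int a + p'" and ?Q = "q * int a + q'"
    have det': "\<bar>?P * q - p * ?Q\<bar> = 1" using det by (rule det_child)
    have "q \<le> q * int a" using au(1) q by simp
    then have Q': "0 < ?Q" "Q \<le> ?Q" using q k by linarith+
    have "\<delta> / (real_of_int ?Q)\<^sup>2 \<le> \<bar>x - ?P / ?Q\<bar>"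
      using bad Q' coprime_of_det[OF det'] by blast
    then have "u < real M + 1"
      using complete_quotient_bound[OF \<delta> Q'(1) _ det' au(3)] au(5) q by auto
    then have "x \<in> C (Q, ?P, ?Q, p, q)"
      using au bad by (auto simp: C_def bad_cyl_def)
    moreover have "(Q, ?P, ?Q, p, q) \<in> I"
      using det' Q' q by (auto simp: I_def)
    ultimately show "x \<in> (\<Union>i\<in>I. C i)" by blast
  qed
  moreover have "hausdorff_measure s (\<Union>i\<in>I. C i) = 0"
    by (rule hausdorff_measure_UN_eq_0)
      (auto simp: I_def C_def intro!: hausdorff_measure_bad_cyl assms)
  ultimately show ?thesis
    using hausdorff_measure_mono[of "Bad \<delta>" "\<Union>i\<in>I. C i" s] by simp
qed

lemma hausdorff_dim_Bad_le:
  assumes "0 < \<delta>" "1 / \<delta> < real M + 1" "0 < M" "0 < s" "s \<le> 1" "real M < (real M + 1) powr s"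
  shows "hausdorff_dim (Bad \<delta>) \<le> ereal s"
  unfolding hausdorff_dim_def using hausdorff_measure_Bad[OF assms] assms(4)
  by (intro INF_lower) auto

section \<open>Comparison of the bounds\<close>

text \<open>In logarithms, lowering the exponent from 1 to \<open>s\<close> costs less than
  \<open>2 / R \<le> 1 / (M + 1)\<close>, while \<open>ln (M + 1)\<close> exceeds
  \<open>ln M\<close> by at least \<open>1 / (M + 1)\<close>.\<close>

lemma less_powr_of_gap:
  fixes M R s :: real
  assumes M: "1 \<le> M" "2 * (M + 1) \<le> R" and s: "1 - s \<le> 2 / (R * ln R)"
  shows "M < (M + 1) powr s"
proof -
  have R: "M + 1 < R" using M by argo
  have lnM: "0 < ln (M + 1)" "ln (M + 1) < ln R" using M R by auto
  have "ln M - ln (M + 1) \<le> M / (M + 1) - 1"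
    using M ln_le_minus_one[of "M / (M + 1)"] by (simp add: ln_div)
  also have "\<dots> = - (1 / (M + 1))" using M by (simp add: field_simps)
  finally have gap: "1 / (M + 1) \<le> ln (M + 1) - ln M" by simp
  have "(1 - s) * ln (M + 1) \<le> 2 / (R * ln R) * ln (M + 1)"
    using s lnM by (intro mult_right_mono) auto
  also have "\<dots> < 2 / (R * ln R) * ln R"
    using lnM R M by (intro mult_strict_left_mono) auto
  also have "\<dots> = 2 / R" using lnM by simp
  also have "\<dots> \<le> 1 / (M + 1)" using M by (simp add: field_simps)
  finally have "ln M < s * ln (M + 1)" using gap by (simp add: algebra_simps)
  then have "exp (ln M) < exp (s * ln (M + 1))" by simp
  then show ?thesis using M by (simp add: powr_def)
qed

theorem theorem1p12:
  fixes \<delta> :: real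
  assumes "0 < \<delta>" and "\<delta> < 1 / sqrt 5"
  shows "(hausdorff_dim (Bad \<delta>)
            \<le> ereal ((ln 2 + ln (real_of_int (\<lceil>648 / \<delta>\<^sup>2\<rceil> - \<lfloor>36 / \<delta>\<rfloor> + 2)))
                      / (2 * ln (36 / \<delta>)))
          \<and> (ln 2 + ln (real_of_int (\<lceil>648 / \<delta>\<^sup>2\<rceil> - \<lfloor>36 / \<delta>\<rfloor> + 2)))
                      / (2 * ln (36 / \<delta>)) < 1)
       \<and> (18 / \<delta> \<in> \<nat> \<longrightarrow>
            hausdorff_dim (Bad \<delta>)
              \<le> ereal (1 + ln (1 - \<delta> / 18 + \<delta>\<^sup>2 / 648) / (2 * ln (36 / \<delta>)))
          \<and> 1 + ln (1 - \<delta> / 18 + \<delta>\<^sup>2 / 648) / (2 * ln (36 / \<delta>)) < 1)"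
proof -
  define R where "R = 36 / \<delta>"
  define K where "K = real_of_int (\<lceil>648 / \<delta>\<^sup>2\<rceil> - \<lfloor>36 / \<delta>\<rfloor> + 2)"
  \<comment> \<open>\<open>s1\<close> and \<open>s2\<close> are the two bounds of the theorem,
    rewritten in terms of \<open>R = 36 / \<delta>\<close>.\<close>
  define s1 where "s1 = (ln 2 + ln K) / (2 * ln R)"
  define w where "w = 1 - 2 / R + 2 / R\<^sup>2"
  define s2 where "s2 = 1 + ln w / (2 * ln R)"
  define M where "M = nat \<lfloor>1 / \<delta>\<rfloor>"
  have "sqrt 5 > 2" by (simp add: real_less_rsqrt)
  then have "1 / sqrt 5 < 1 / 2" by (intro divide_strict_left_mono) auto
  then have \<delta>: "0 < \<delta>" "\<delta> < 1 / 2" using assms by linarith+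
  have inv: "2 < 1 / \<delta>" using \<delta> by (simp add: field_simps)
  have R_eq: "R = 36 * (1 / \<delta>)" by (simp add: R_def)
  have R: "72 < R" using inv unfolding R_eq by argo
  have M1: "real M = \<lfloor>1 / \<delta>\<rfloor>" using \<delta> by (simp add: M_def)
  then have M: "1 / \<delta> < real M + 1" "1 \<le> real M" "0 < M" and "real M \<le> 1 / \<delta>"
    using inv by linarith+
  then have MR: "2 * (real M + 1) \<le> R"
    unfolding R_eq by argo
  have lnR: "0 < ln R" using R by simp
  have w_eq: "1 - \<delta> / 18 + \<delta>\<^sup>2 / 648 = w"
    using \<delta> by (simp add: w_def R_def power2_eq_square)
  have "2 / R < 1 / 36" "2 / R\<^sup>2 > 0" using R by (simp_all add: field_simps)
  then have w: "1 / 2 \<le> w" unfolding w_def by linarith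
  have "w = 1 - 2 / R * (1 - 1 / R)" using R by (simp add: w_def field_simps power2_eq_square)
  also have "\<dots> < 1" using R by (simp add: field_simps)
  finally have w1: "w < 1" .
  \<comment> \<open>Since \<open>w \<ge> 1 / 2\<close>, this quantity is at most
    \<open>2 * (1 - w) \<le> 4 / R\<close>, which gives the gap between \<open>s2\<close> and
    1.\<close>
  have "- ln w = ln (1 / w)" using w by (simp add: ln_div)
  also have "\<dots> \<le> 1 / w - 1" using w by (intro ln_le_minus_one) auto
  also have "\<dots> = (1 - w) / w" using w by (simp add: field_simps)
  also have "\<dots> \<le> (1 - w) / (1 / 2)" using w w1 by (intro divide_left_mono) auto
  also have "\<dots> \<le> 4 / R" using R by (simp add: w_def)
  finally have "- ln w / (2 * ln R) \<le> (4 / R) / (2 * ln R)"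
    using lnR by (intro divide_right_mono) auto
  then have "1 - s2 \<le> (4 / R) / (2 * ln R)"
    by (simp add: s2_def)
  then have gap: "1 - s2 \<le> 2 / (R * ln R)" using R by simp
  have s2_1: "s2 < 1" using w w1 lnR by (simp add: s2_def divide_neg_pos)
  have RR: "72 * R < R\<^sup>2" using R by (simp add: power2_eq_square)
  have half: "648 / \<delta>\<^sup>2 = R\<^sup>2 / 2" by (simp add: R_def power2_eq_square)
  \<comment> \<open>Rounding up the first term and rounding down the subtracted one each raise
    \<open>K\<close> by less than 1.\<close>
  have K: "R\<^sup>2 / 2 - R + 2 \<le> K" "K < R\<^sup>2 / 2 - R + 4"
    unfolding K_def half R_def[symmetric] by linarith+
  have Kpos: "0 < K" using K(1) RR R by argo
  have ln2K: "ln 2 + ln K = ln (2 * K)" using Kpos by (simp add: ln_mult)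
  have lnR2: "2 * ln R = ln (R\<^sup>2)" using R by (simp add: ln_realpow)
  \<comment> \<open>\<open>s2\<close> equals \<open>ln (R\<^sup>2 * w) / (2 * ln R)\<close>, so
    comparing \<open>R\<^sup>2 * w\<close> with \<open>2 * K\<close> gives
    \<open>s2 \<le> s1\<close>.\<close>
  have "R\<^sup>2 * w = R\<^sup>2 - 2 * R + 2" using R by (simp add: w_def field_simps power2_eq_square)
  then have "R\<^sup>2 * w \<le> 2 * K" using K(1) by argo
  moreover have "0 < R\<^sup>2 * w" using w R by simp
  ultimately have "ln (R\<^sup>2 * w) \<le> ln (2 * K)" by (intro ln_mono) auto
  moreover have "ln (R\<^sup>2 * w) = 2 * ln R + ln w" using w R by (simp add: ln_mult lnR2)
  ultimately have "(2 * ln R + ln w) / (2 * ln R) \<le> s1"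
    unfolding s1_def ln2K using lnR by (intro divide_right_mono) auto
  then have s21: "s2 \<le> s1" using lnR by (simp add: s2_def add_divide_distrib)
  have "2 * K < R\<^sup>2" using K(2) R by argo
  then have "ln (2 * K) < 2 * ln R"
    unfolding lnR2 using Kpos R by (subst ln_less_cancel_iff) auto
  then have s1_1: "s1 < 1" unfolding s1_def ln2K using lnR by simp
  \<comment> \<open>Together with the gap this gives \<open>0 < s2\<close>, since the dimension
    bound requires a positive exponent.\<close>
  have "2 / (R * ln R) < 1"
  proof -
    have "ln (exp 1) \<le> ln R" using R exp_le by (intro ln_mono) auto
    then have "R * 1 \<le> R * ln R" using R by (intro mult_left_mono) auto
    then have "2 < R * ln R" using R by argo
    then show ?thesis by simp
  qed
  then have s2_0: "0 < s2" using gap by linarith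
  \<comment> \<open>Any exponent from \<open>s2\<close> up to 1 has a small enough gap, so one claim
    serves both \<open>s1\<close> and \<open>s2\<close>.\<close>
  have dim: "hausdorff_dim (Bad \<delta>) \<le> ereal s" if "s2 \<le> s" "s < 1" for s
    using that s2_0 \<delta> M MR gap
    by (intro hausdorff_dim_Bad_le[where M=M] less_powr_of_gap[where R=R]) auto
  show ?thesis
    unfolding w_eq R_def[symmetric]
    unfolding K_def[unfolded R_def[symmetric], symmetric] s1_def[symmetric] s2_def[symmetric]
    using dim s21 s1_1 s2_1 by simp
qed

end
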